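(* Let $(A,\prec,\succ)$ be a dendriform algebra. If $H^2_{\mathrm{dend}}(A,A)=0$, then $A$ is rigid.
   Context: $\mathbb{K}$ is a field of characteristic $0$; all spaces and maps are over $\mathbb{K}$. Dendriform algebra: a vector space $A$ with bilinear $\prec,\succ$ satisfying $(a\prec b)\prec c=a\prec(b\prec c+b\succ c)$, $(a\succ b)\prec c=a\succ(b\prec c)$, $(a\prec b+a\succ b)\succ c=a\succ(b\succ c)$. $C_n=\{[1],\ldots,[n]\}$ is a set of $n$ symbols, $\mathbb{K}[C_n]$ the vector space with basis $C_n$. For $1\le i\le m$, $n\ge 1$: $R_0^{m,n,i}:C_{m+n-1}\to C_m$ sends $[r]$ to $[r]$ if $r\le i-1$, to $[i]$ if $i\le r\le i+n-1$, to $[r-n+1]$ if $r\ge i+n$; $R^{m,n,i}:C_{m+n-1}\to\mathbb{K}[C_n]$ sends $[r]$ to $[r-i+1]$ if $i\le r\le i+n-1$ and to $[1]+\cdots+[n]$ otherwise. Put $\pi_A([1];a,b)=a\prec b$, $\pi_A([2];a,b)=a\succ b$. Cochains: $C^n_{\mathrm{dend}}(A,A)=\mathrm{Hom}_{\mathbb{K}}(\mathbb{K}[C_n]\otimes A^{\otimes n},A)$, $n\ge1$, with $$(\delta_{\mathrm{dend}}f)([r];a_1,\ldots,a_{n+1})=\pi_A\big(R_0^{2,n,2}[r];a_1,f(R^{2,n,2}[r];a_2,\ldots,a_{n+1})\big)$$ $$+\sum_{i=1}^n(-1)^i f\big(R_0^{n,2,i}[r];a_1,\ldots,a_{i-1},\pi_A(R^{n,2,i}[r];a_i,a_{i+1}),a_{i+2},\ldots,a_{n+1}\big)$$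 $$+(-1)^{n+1}\pi_A\big(R_0^{2,n,1}[r];f(R^{2,n,1}[r];a_1,\ldots,a_n),a_{n+1}\big).$$ $H^n_{\mathrm{dend}}(A,A)$ is the resulting cohomology, $n\ge2$. A formal $1$-parameter deformation of $A$ is a pair of $\mathbb{K}[[t]]$-bilinear maps $\prec_t,\succ_t:A[[t]]\times A[[t]]\to A[[t]]$ of the form $a\prec_t b=\sum_{i\ge0}(a\prec_i b)t^i$, $a\succ_t b=\sum_{i\ge0}(a\succ_i b)t^i$ for $a,b\in A$ (extended $t$-adically, with $\prec_i,\succ_i:A\otimes A\to A$ bilinear), with $\prec_0=\prec$, $\succ_0=\succ$, such that $(A[[t]],\prec_t,\succ_t)$ is a dendriform algebra. Two deformations $(\prec_t,\succ_t)$ and $(\prec_t',\succ_t')$ are equivalent if there is a formal map $\phi_t=\sum_{i\ge0}\phi_i t^i$ with $\phi_i\in\mathrm{Hom}_{\mathbb{K}}(A,A)$, $\phi_0=\mathrm{id}_A$, such that $\phi_t(a\prec_t b)=\phi_t(a)\prec_t'\phi_t(b)$ and $\phi_t(a\succ_t b)=\phi_t(a)\succ_t'\phi_t(b)$. $A$ is rigid if every deformation of $A$ is equivalent to the trivial deformation $(\prec_t=\prec,\ \succ_t=\succ)$. *)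

theory Defs
  imports
    "HOL-Computational_Algebra.Formal_Power_Series"
    "HOL-Library.Function_Algebras"
    "HOL-Library.Set_Algebras"
begin

section \<open>Dendriform algebras\<close>

definition bilinear_map :: "('k::comm_ring_1 \<Rightarrow> 'a::ab_group_add \<Rightarrow> 'a) \<Rightarrow> ('a \<Rightarrow> 'a \<Rightarrow> 'a) \<Rightarrow> bool" where
  "bilinear_map scale f \<longleftrightarrow>
    (\<forall>a. module_hom scale scale (f a)) \<and> (\<forall>b. module_hom scale scale (\<lambda>a. f a b))"

text \<open>The scalars form an arbitrary commutative ring, so that the same notion applies to a
  vector space over a field \<open>K\<close> and to the \<open>K[[t]]\<close>-module \<open>A[[t]]\<close>.\<close>

locale dendriform_algebra = module scale
  for scale :: "'k::comm_ring_1 \<Rightarrow> 'a::ab_group_add \<Rightarrow> 'a" +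
  fixes prec succ :: "'a \<Rightarrow> 'a \<Rightarrow> 'a"
  assumes bilinear_prec: "bilinear_map scale prec"
    and bilinear_succ: "bilinear_map scale succ"
    and prec_prec: "prec (prec a b) c = prec a (prec b c + succ b c)"
    and succ_prec: "prec (succ a b) c = succ a (prec b c)"
    and succ_succ: "succ (prec a b + succ a b) c = succ a (succ b c)"

section \<open>Dendriform cohomology\<close>

text \<open>The symbol \<open>[r]\<close> of \<open>C\<^sub>n\<close> is encoded by the number \<open>r \<in> {1..n}\<close>, and an element of \<open>K[C\<^sub>n]\<close>
  by its coefficient function. A linear map on \<open>K[C\<^sub>n]\<close> is given by its values \<open>g s\<close> on the
  basis; \<open>free_ext\<close> evaluates its linear extension.\<close>

definition free_ext :: "('k \<Rightarrow> 'a \<Rightarrow> 'a::ab_group_add) \<Rightarrow> nat \<Rightarrow> (nat \<Rightarrow> 'a) \<Rightarrow> (nat \<Rightarrow> 'k) \<Rightarrow> 'a" where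
  "free_ext scale n g v = (\<Sum>s = 1..n. scale (v s) (g s))"

definition R0 :: "nat \<Rightarrow> nat \<Rightarrow> nat \<Rightarrow> nat \<Rightarrow> nat" where
  "R0 m n i r = (if r \<le> i - 1 then r else if r \<le> i + n - 1 then i else r - n + 1)"

definition R :: "nat \<Rightarrow> nat \<Rightarrow> nat \<Rightarrow> nat \<Rightarrow> (nat \<Rightarrow> 'k::comm_ring_1)" where
  "R m n i r = (if i \<le> r \<and> r \<le> i + n - 1
     then (\<lambda>s. if s = r - i + 1 then 1 else 0)
     else (\<lambda>s. if s \<in> {1..n} then 1 else 0))"

definition dend_pi :: "('a \<Rightarrow> 'a \<Rightarrow> 'a) \<Rightarrow> ('a \<Rightarrow> 'a \<Rightarrow> 'a) \<Rightarrow> nat \<Rightarrow> 'a \<Rightarrow> 'a \<Rightarrow> 'a" where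
  "dend_pi prec succ r a b = (if r = 1 then prec a b else succ a b)"

text \<open>An element of \<open>Hom (K[C\<^sub>n] \<otimes> A\<^sup>\<otimes>\<^sup>n, A)\<close> is a family, indexed by the basis \<open>C\<^sub>n\<close>, of maps that are
  multilinear in a list of \<open>n\<close> arguments. Values outside this domain are fixed to be 0, so that
  equality of cochains is equality of functions.\<close>

definition dend_cochains :: "('k::comm_ring_1 \<Rightarrow> 'a::ab_group_add \<Rightarrow> 'a) \<Rightarrow> nat \<Rightarrow> (nat \<Rightarrow> 'a list \<Rightarrow> 'a) set" where
  "dend_cochains scale n = {f.
     (\<forall>r\<in>{1..n}. \<forall>as. length as = n \<longrightarrow>
        (\<forall>j<n. module_hom scale scale (\<lambda>x. f r (as[j := x])))) \<and>
     (\<forall>r as. \<not> (r \<in> {1..n} \<and> length as = n) \<longrightarrow> f r as = 0)}"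

text \<open>With \<open>as = [a\<^sub>1, \<dots>, a\<^sub>n\<^sub>+\<^sub>1]\<close>, the argument \<open>a\<^sub>i\<close> is \<open>as ! (i - 1)\<close>.\<close>

definition dend_delta ::
  "('k::comm_ring_1 \<Rightarrow> 'a::ab_group_add \<Rightarrow> 'a) \<Rightarrow> ('a \<Rightarrow> 'a \<Rightarrow> 'a) \<Rightarrow> ('a \<Rightarrow> 'a \<Rightarrow> 'a) \<Rightarrow>
   nat \<Rightarrow> (nat \<Rightarrow> 'a list \<Rightarrow> 'a) \<Rightarrow> (nat \<Rightarrow> 'a list \<Rightarrow> 'a)" where
  "dend_delta scale prec succ n f r as =
    (if r \<in> {1..n + 1} \<and> length as = n + 1 then
       dend_pi prec succ (R0 2 n 2 r) (hd as) (free_ext scale n (\<lambda>s. f s (tl as)) (R 2 n 2 r))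
     + (\<Sum>i = 1..n. scale ((- 1) ^ i)
          (f (R0 n 2 i r)
             (take (i - 1) as
              @ [free_ext scale 2 (\<lambda>s. dend_pi prec succ s (as ! (i - 1)) (as ! i)) (R n 2 i r)]
              @ drop (i + 1) as)))
     + scale ((- 1) ^ (n + 1))
         (dend_pi prec succ (R0 2 n 1 r)
            (free_ext scale n (\<lambda>s. f s (butlast as)) (R 2 n 1 r)) (last as))
     else 0)"

definition dend_cocycles ::
  "('k::comm_ring_1 \<Rightarrow> 'a::ab_group_add \<Rightarrow> 'a) \<Rightarrow> ('a \<Rightarrow> 'a \<Rightarrow> 'a) \<Rightarrow> ('a \<Rightarrow> 'a \<Rightarrow> 'a) \<Rightarrow>
   nat \<Rightarrow> (nat \<Rightarrow> 'a list \<Rightarrow> 'a) set" where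
  "dend_cocycles scale prec succ n = {f \<in> dend_cochains scale n. dend_delta scale prec succ n f = 0}"

definition dend_coboundaries ::
  "('k::comm_ring_1 \<Rightarrow> 'a::ab_group_add \<Rightarrow> 'a) \<Rightarrow> ('a \<Rightarrow> 'a \<Rightarrow> 'a) \<Rightarrow> ('a \<Rightarrow> 'a \<Rightarrow> 'a) \<Rightarrow>
   nat \<Rightarrow> (nat \<Rightarrow> 'a list \<Rightarrow> 'a) set" where
  "dend_coboundaries scale prec succ n = dend_delta scale prec succ (n - 1) ` dend_cochains scale (n - 1)"

text \<open>The quotient of cocycles by coboundaries, as the set of cosets; used for \<open>n \<ge> 2\<close>. Its zero
  element is the coset \<open>dend_coboundaries scale prec succ n\<close>.\<close>

definition dend_cohomology ::
  "('k::comm_ring_1 \<Rightarrow> 'a::ab_group_add \<Rightarrow> 'a) \<Rightarrow> ('a \<Rightarrow> 'a \<Rightarrow> 'a) \<Rightarrow> ('a \<Rightarrow> 'a \<Rightarrow> 'a) \<Rightarrow>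
   nat \<Rightarrow> (nat \<Rightarrow> 'a list \<Rightarrow> 'a) set set" where
  "dend_cohomology scale prec succ n =
    (\<lambda>f. f +o dend_coboundaries scale prec succ n) ` dend_cocycles scale prec succ n"

section \<open>Formal deformations\<close>

text \<open>\<open>A[[t]]\<close> is the type \<open>'a fps\<close> and \<open>K[[t]]\<close> the ring \<open>'k fps\<close>.\<close>

definition fps_scale :: "('k \<Rightarrow> 'a \<Rightarrow> 'a::ab_group_add) \<Rightarrow> 'k fps \<Rightarrow> 'a fps \<Rightarrow> 'a fps" where
  "fps_scale scale c x = Abs_fps (\<lambda>n. \<Sum>i\<le>n. scale (fps_nth c i) (fps_nth x (n - i)))"

definition fps_product :: "(nat \<Rightarrow> 'a \<Rightarrow> 'a \<Rightarrow> 'a::ab_group_add) \<Rightarrow> 'a fps \<Rightarrow> 'a fps \<Rightarrow> 'a fps" where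
  "fps_product p x y =
    Abs_fps (\<lambda>n. \<Sum>i\<le>n. \<Sum>j\<le>n - i. p i (fps_nth x j) (fps_nth y (n - i - j)))"

definition fps_map :: "(nat \<Rightarrow> 'a \<Rightarrow> 'a::ab_group_add) \<Rightarrow> 'a fps \<Rightarrow> 'a fps" where
  "fps_map \<phi> x = Abs_fps (\<lambda>n. \<Sum>i\<le>n. \<phi> i (fps_nth x (n - i)))"

definition formal_deformation ::
  "('k::comm_ring_1 \<Rightarrow> 'a::ab_group_add \<Rightarrow> 'a) \<Rightarrow> ('a \<Rightarrow> 'a \<Rightarrow> 'a) \<Rightarrow> ('a \<Rightarrow> 'a \<Rightarrow> 'a) \<Rightarrow>
   ('a fps \<Rightarrow> 'a fps \<Rightarrow> 'a fps) \<Rightarrow> ('a fps \<Rightarrow> 'a fps \<Rightarrow> 'a fps) \<Rightarrow> bool" where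
  "formal_deformation scale prec succ prec_t succ_t \<longleftrightarrow>
    (\<exists>p s. (\<forall>i. bilinear_map scale (p i)) \<and> (\<forall>i. bilinear_map scale (s i)) \<and>
       p 0 = prec \<and> s 0 = succ \<and> prec_t = fps_product p \<and> succ_t = fps_product s) \<and>
    dendriform_algebra (fps_scale scale) prec_t succ_t"

definition equivalent_deformations ::
  "('k::comm_ring_1 \<Rightarrow> 'a::ab_group_add \<Rightarrow> 'a) \<Rightarrow>
   ('a fps \<Rightarrow> 'a fps \<Rightarrow> 'a fps) \<Rightarrow> ('a fps \<Rightarrow> 'a fps \<Rightarrow> 'a fps) \<Rightarrow>
   ('a fps \<Rightarrow> 'a fps \<Rightarrow> 'a fps) \<Rightarrow> ('a fps \<Rightarrow> 'a fps \<Rightarrow> 'a fps) \<Rightarrow> bool" where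
  "equivalent_deformations scale prec_t succ_t prec_t' succ_t' \<longleftrightarrow>
    (\<exists>\<phi>. (\<forall>i. module_hom scale scale (\<phi> i)) \<and> \<phi> 0 = id \<and>
       (\<forall>x y. fps_map \<phi> (prec_t x y) = prec_t' (fps_map \<phi> x) (fps_map \<phi> y)) \<and>
       (\<forall>x y. fps_map \<phi> (succ_t x y) = succ_t' (fps_map \<phi> x) (fps_map \<phi> y)))"

definition trivial_product :: "('a \<Rightarrow> 'a \<Rightarrow> 'a::ab_group_add) \<Rightarrow> 'a fps \<Rightarrow> 'a fps \<Rightarrow> 'a fps" where
  "trivial_product m = fps_product (\<lambda>i. if i = 0 then m else (\<lambda>a b. 0))"

definition dend_rigid ::
  "('k::comm_ring_1 \<Rightarrow> 'a::ab_group_add \<Rightarrow> 'a) \<Rightarrow> ('a \<Rightarrow> 'a \<Rightarrow> 'a) \<Rightarrow> ('a \<Rightarrow> 'a \<Rightarrow> 'a) \<Rightarrow> bool" where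
  "dend_rigid scale prec succ \<longleftrightarrow>
    (\<forall>prec_t succ_t. formal_deformation scale prec succ prec_t succ_t \<longrightarrow>
       equivalent_deformations scale prec_t succ_t (trivial_product prec) (trivial_product succ))"

end

theory Submission
  imports Defs
begin

text \<open>Let \<open>\<prec>\<^sub>t = \<Sum> p\<^sub>i t\<^sup>i\<close> and \<open>\<succ>\<^sub>t = \<Sum> s\<^sub>i t\<^sup>i\<close> be a deformation. A formal map \<open>\<phi>\<close> with \<open>\<phi>\<^sub>0 = id\<close> is an
  equivalence to the trivial deformation iff its defects \<open>\<phi>(x \<prec>\<^sub>t y) - \<phi>(x) \<prec> \<phi>(y)\<close> and
  \<open>\<phi>(x \<succ>\<^sub>t y) - \<phi>(x) \<succ> \<phi>(y)\<close> vanish. The coefficients \<open>\<phi>\<^sub>0, \<phi>\<^sub>1, \<dots>\<close> are chosen one at a time so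
  that the defects vanish to higher and higher order in \<open>t\<close>.

  Suppose the defects vanish below order \<open>N > 0\<close>. Each dendriform axiom has the shape
  \<open>f (g a b) c = f' a (g' b c)\<close>, where \<open>f, g, f', g'\<close> are among \<open>\<prec>\<close>, \<open>\<succ>\<close> and their sum. Applying \<open>\<phi>\<close>
  to the same axiom for the deformed products, moving \<open>\<phi>\<close> inwards on both sides and comparing
  coefficients of \<open>t\<^sup>N\<close> gives one linear identity between the order-\<open>N\<close> defects
  (\<open>defect_cocycle_identity\<close>). The three identities obtained in this way say that the order-\<open>N\<close>
  defects form a 2-cocycle. As \<open>H\<^sup>2 = 0\<close>, this cocycle is \<open>\<delta>\<psi>\<close> for a linear map \<open>\<psi>\<close>
  (\<open>trivial_cohomology_two_primitive\<close>), and replacing \<open>\<phi>\<^sub>N\<close> by \<open>\<phi>\<^sub>N + \<psi>\<close> subtracts \<open>\<delta>\<psi>\<close> from the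
  order-\<open>N\<close> defects (\<open>defect_update\<close>) without changing the lower ones.\<close>

section \<open>Bilinear maps\<close>

lemma bilinear_map_iff:
  "bilinear_map scale f \<longleftrightarrow> module scale \<and>
    (\<forall>a b c. f (a + b) c = f a c + f b c) \<and> (\<forall>a b c. f a (b + c) = f a b + f a c) \<and>
    (\<forall>r a b. f (scale r a) b = scale r (f a b)) \<and> (\<forall>r a b. f a (scale r b) = scale r (f a b))"
  unfolding bilinear_map_def module_hom_iff by auto

lemma
  assumes "bilinear_map scale f"
  shows bilinear_map_add_left: "f (a + b) c = f a c + f b c"
    and bilinear_map_add_right: "f a (b + c) = f a b + f a c"
    and bilinear_map_zero_left: "f 0 c = 0"
    and bilinear_map_zero_right: "f a 0 = 0"
proof -
  have l: "\<And>a b c. f (a + b) c = f a c + f b c" and r: "\<And>a b c. f a (b + c) = f a b + f a c"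
    using assms unfolding bilinear_map_iff by auto
  show "f (a + b) c = f a c + f b c" "f a (b + c) = f a b + f a c" by (rule l, rule r)
  show "f 0 c = 0" using l[of 0 0 c] by simp
  show "f a 0 = 0" using r[of a 0 0] by simp
qed

lemma bilinear_map_sum_left:
  assumes "bilinear_map scale f"
  shows "f (\<Sum>i\<in>I. u i) c = (\<Sum>i\<in>I. f (u i) c)"
  by (induction I rule: infinite_finite_induct)
    (simp_all add: bilinear_map_add_left[OF assms] bilinear_map_zero_left[OF assms])

lemma bilinear_map_sum_right:
  assumes "bilinear_map scale f"
  shows "f a (\<Sum>i\<in>I. u i) = (\<Sum>i\<in>I. f a (u i))"
  by (induction I rule: infinite_finite_induct)
    (simp_all add: bilinear_map_add_right[OF assms] bilinear_map_zero_right[OF assms])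

lemma bilinear_map_plus:
  assumes "bilinear_map scale f" "bilinear_map scale g"
  shows "bilinear_map scale (\<lambda>a b. f a b + g a b)"
  using assms unfolding bilinear_map_iff by (auto simp: module.scale_right_distrib)

lemma module_hom_add: "module_hom s1 s2 f \<Longrightarrow> f (a + b) = f a + f b"
  by (simp add: module_hom_iff)

lemma module_hom_zero: "module_hom s1 s2 f \<Longrightarrow> f 0 = 0"
  using module_hom_add[of s1 s2 f 0 0] by simp

lemma module_hom_sum: "module_hom s1 s2 f \<Longrightarrow> f (\<Sum>i\<in>I. u i) = (\<Sum>i\<in>I. f (u i))"
  by (induction I rule: infinite_finite_induct) (simp_all add: module_hom_add module_hom_zero)

section \<open>Products of formal power series\<close>

lemma trivial_product_nth:
  "fps_nth (trivial_product f x y) n = (\<Sum>j\<le>n. f (fps_nth x j) (fps_nth y (n - j)))"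
proof -
  have "fps_nth (trivial_product f x y) n =
      (\<Sum>i\<le>n. if i = 0 then \<Sum>j\<le>n. f (fps_nth x j) (fps_nth y (n - j)) else 0)"
    unfolding trivial_product_def fps_product_def fps_nth_Abs_fps by (rule sum.cong) auto
  then show ?thesis by (simp add: sum.delta)
qed

lemma trivial_product_add_left:
  assumes "bilinear_map scale f"
  shows "trivial_product f (x + y) z = trivial_product f x z + trivial_product f y z"
  by (rule fps_ext) (simp add: trivial_product_nth bilinear_map_add_left[OF assms] sum.distrib)

lemma trivial_product_add_right:
  assumes "bilinear_map scale f"
  shows "trivial_product f x (y + z) = trivial_product f x y + trivial_product f x z"
  by (rule fps_ext) (simp add: trivial_product_nth bilinear_map_add_right[OF assms] sum.distrib)

text \<open>A mixed associativity law on \<open>A\<close> extends to \<open>A[[t]]\<close>.\<close>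

lemma trivial_product_assoc:
  assumes f: "bilinear_map scale f" and f': "bilinear_map scale f'"
    and assoc: "\<And>a b c. f (g a b) c = f' a (g' b c)"
  shows "trivial_product f (trivial_product g x y) z = trivial_product f' x (trivial_product g' y z)"
proof (rule fps_ext)
  fix n
  let ?T = "\<lambda>i j k. f' (fps_nth x i) (g' (fps_nth y j) (fps_nth z k))"
  have "(\<Sum>(j,k)\<in>Sigma {..n} (\<lambda>j. {..j}). ?T k (j - k) (n - j)) =
      (\<Sum>(j,k)\<in>Sigma {..n} (\<lambda>j. {..n - j}). ?T j k (n - j - k))"
    by (rule sum.reindex_bij_witness[where j = "\<lambda>(j,k). (k, j - k)" and i = "\<lambda>(j,k). (j + k, j)"])
      auto
  then show "fps_nth (trivial_product f (trivial_product g x y) z) n =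
      fps_nth (trivial_product f' x (trivial_product g' y z)) n"
    by (simp add: trivial_product_nth bilinear_map_sum_left[OF f] bilinear_map_sum_right[OF f']
        assoc sum.Sigma)
qed

lemma fps_product_plus:
  "fps_product (\<lambda>i a b. p i a b + q i a b) x y = fps_product p x y + fps_product q x y"
  by (rule fps_ext) (simp add: fps_product_def sum.distrib)

lemma fps_map_product:
  assumes lin: "\<And>i. module_hom scale scale (\<phi> i)"
  shows "fps_map \<phi> (fps_product p x y) = fps_product (\<lambda>m a b. \<Sum>k\<le>m. \<phi> k (p (m - k) a b)) x y"
proof (rule fps_ext)
  fix n
  let ?T = "\<lambda>k i j l. \<phi> k (p i (fps_nth x j) (fps_nth y l))"
  have "(\<Sum>(k,i,j)\<in>(SIGMA k:{..n}. SIGMA i:{..n - k}. {..n - k - i}). ?T k i j (n - k - i - j)) =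
      (\<Sum>(m,j,k)\<in>(SIGMA m:{..n}. SIGMA j:{..n - m}. {..m}). ?T k (m - k) j (n - m - j))"
    by (rule sum.reindex_bij_witness[where j = "\<lambda>(k,i,j). (k + i, j, k)"
          and i = "\<lambda>(m,j,k). (k, m - k, j)"]) auto
  then show "fps_nth (fps_map \<phi> (fps_product p x y)) n =
      fps_nth (fps_product (\<lambda>m a b. \<Sum>k\<le>m. \<phi> k (p (m - k) a b)) x y) n"
    by (simp add: fps_map_def fps_product_def module_hom_sum[OF lin] sum.Sigma split_def
        ac_simps)
qed

lemma trivial_product_fps_map:
  assumes q: "bilinear_map scale q"
  shows "trivial_product q (fps_map \<phi> x) (fps_map \<phi> y) =
    fps_product (\<lambda>m a b. \<Sum>k\<le>m. q (\<phi> k a) (\<phi> (m - k) b)) x y"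
proof (rule fps_ext)
  fix n
  let ?T = "\<lambda>k l i j. q (\<phi> k (fps_nth x i)) (\<phi> l (fps_nth y j))"
  have "(\<Sum>(j,l,k)\<in>(SIGMA j:{..n}. SIGMA l:{..n - j}. {..j}). ?T k l (j - k) (n - j - l)) =
      (\<Sum>(m,j,k)\<in>(SIGMA m:{..n}. SIGMA j:{..n - m}. {..m}). ?T k (m - k) j (n - m - j))"
    by (rule sum.reindex_bij_witness[where j = "\<lambda>(j,l,k). (k + l, j - k, k)"
          and i = "\<lambda>(m,j,k). (j + k, m - k, k)"]) (auto simp: add.commute)
  then show "fps_nth (trivial_product q (fps_map \<phi> x) (fps_map \<phi> y)) n =
      fps_nth (fps_product (\<lambda>m a b. \<Sum>k\<le>m. q (\<phi> k a) (\<phi> (m - k) b)) x y) n"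
    by (simp add: trivial_product_nth fps_map_def fps_product_def bilinear_map_sum_left[OF q]
        bilinear_map_sum_right[OF q] sum.Sigma split_def ac_simps)
qed

section \<open>The defect of a formal map\<close>

text \<open>The coefficient of \<open>t\<^sup>m\<close> in \<open>\<phi>(p\<^sub>t(a, b)) - q(\<phi>(a), \<phi>(b))\<close> for constant series \<open>a\<close> and \<open>b\<close>.\<close>

definition defect ::
  "(nat \<Rightarrow> 'a \<Rightarrow> 'a) \<Rightarrow> (nat \<Rightarrow> 'a \<Rightarrow> 'a \<Rightarrow> 'a) \<Rightarrow> ('a \<Rightarrow> 'a \<Rightarrow> 'a) \<Rightarrow> nat \<Rightarrow> 'a \<Rightarrow> 'a \<Rightarrow> 'a::ab_group_add"
  where "defect \<phi> p q m a b =
    (\<Sum>k\<le>m. \<phi> k (p (m - k) a b)) - (\<Sum>k\<le>m. q (\<phi> k a) (\<phi> (m - k) b))"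

lemma defect_cong:
  assumes "\<And>k. k \<le> m \<Longrightarrow> \<phi> k = \<phi>' k"
  shows "defect \<phi> p q m = defect \<phi>' p q m"
  unfolding defect_def using assms by (auto simp: fun_eq_iff intro!: arg_cong2[of _ _ _ _ minus] sum.cong)

lemma defect_plus:
  assumes "\<And>i. module_hom scale scale (\<phi> i)"
  shows "defect \<phi> (\<lambda>i a b. p i a b + p' i a b) (\<lambda>a b. q a b + q' a b) m a b =
    defect \<phi> p q m a b + defect \<phi> p' q' m a b"
  by (simp add: defect_def module_hom_add[OF assms] sum.distrib)

lemma bilinear_map_defect:
  assumes "module scale" and lin: "\<And>i. module_hom scale scale (\<phi> i)"
    and p: "\<And>i. bilinear_map scale (p i)" and q: "bilinear_map scale q"
  shows "bilinear_map scale (defect \<phi> p q m)"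
proof -
  interpret module scale by fact
  show ?thesis
    using lin p q unfolding bilinear_map_iff module_hom_iff
    by (auto simp: defect_def sum.distrib scale_right_diff_distrib scale_sum_right module_axioms)
qed

lemma fps_map_product_defect:
  assumes lin: "\<And>i. module_hom scale scale (\<phi> i)" and q: "bilinear_map scale q"
  shows "fps_map \<phi> (fps_product p x y) =
    trivial_product q (fps_map \<phi> x) (fps_map \<phi> y) + fps_product (defect \<phi> p q) x y"
proof -
  have "fps_product (\<lambda>m a b. \<Sum>k\<le>m. \<phi> k (p (m - k) a b)) x y =
      fps_product (\<lambda>m a b. (\<Sum>k\<le>m. q (\<phi> k a) (\<phi> (m - k) b)) + defect \<phi> p q m a b) x y"
    by (simp add: defect_def)
  then show ?thesis
    by (simp only: fps_map_product[OF lin] trivial_product_fps_map[OF q] fps_product_plus)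
qed

lemma fps_product_nth_low:
  assumes "\<And>m a b. m < N \<Longrightarrow> d m a b = 0" "m < N"
  shows "fps_nth (fps_product d x y) m = 0"
  using assms by (simp add: fps_product_def)

lemma fps_product_nth_lowest:
  assumes "\<And>m a b. m < N \<Longrightarrow> d m a b = 0"
  shows "fps_nth (fps_product d x y) N = d N (fps_nth x 0) (fps_nth y 0)"
proof -
  have "fps_nth (fps_product d x y) N =
      (\<Sum>i\<le>N. if i = N then d N (fps_nth x 0) (fps_nth y 0) else 0)"
    unfolding fps_product_def fps_nth_Abs_fps by (rule sum.cong) (auto simp: assms)
  then show ?thesis by simp
qed

lemma trivial_product_nth_lowest_left:
  assumes f: "bilinear_map scale f" and low: "\<And>m. m < N \<Longrightarrow> fps_nth x m = 0"
  shows "fps_nth (trivial_product f x y) N = f (fps_nth x N) (fps_nth y 0)"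
proof -
  have "fps_nth (trivial_product f x y) N =
      (\<Sum>i\<le>N. if i = N then f (fps_nth x N) (fps_nth y 0) else 0)"
    unfolding trivial_product_nth
    by (rule sum.cong) (auto simp: low bilinear_map_zero_left[OF f])
  then show ?thesis by simp
qed

lemma trivial_product_nth_lowest_right:
  assumes f: "bilinear_map scale f" and low: "\<And>m. m < N \<Longrightarrow> fps_nth y m = 0"
  shows "fps_nth (trivial_product f x y) N = f (fps_nth x 0) (fps_nth y N)"
proof -
  have "fps_nth (trivial_product f x y) N =
      (\<Sum>i\<le>N. if i = 0 then f (fps_nth x 0) (fps_nth y N) else 0)"
    unfolding trivial_product_nth
    by (rule sum.cong) (auto simp: low bilinear_map_zero_right[OF f])
  then show ?thesis by simp
qed

text \<open>The linearisation at order \<open>N\<close> of an axiom of the form \<open>f (g a b) c = f' a (g' b c)\<close>.\<close>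

lemma defect_cocycle_identity:
  assumes lin: "\<And>i. module_hom scale scale (\<phi> i)" and id: "\<phi> 0 = id"
    and bil: "bilinear_map scale f" "bilinear_map scale g" "bilinear_map scale f'" "bilinear_map scale g'"
    and init: "pg 0 = g" "pg' 0 = g'"
    and assoc: "\<And>a b c. f (g a b) c = f' a (g' b c)"
    and assoc_t: "\<And>x y z. fps_product pf (fps_product pg x y) z =
      fps_product pf' x (fps_product pg' y z)"
    and low: "\<And>m a b. m < N \<Longrightarrow> defect \<phi> pf f m a b = 0"
      "\<And>m a b. m < N \<Longrightarrow> defect \<phi> pg g m a b = 0"
      "\<And>m a b. m < N \<Longrightarrow> defect \<phi> pf' f' m a b = 0"
      "\<And>m a b. m < N \<Longrightarrow> defect \<phi> pg' g' m a b = 0"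
  shows "f (defect \<phi> pg g N a b) c + defect \<phi> pf f N (g a b) c =
    f' a (defect \<phi> pg' g' N b c) + defect \<phi> pf' f' N a (g' b c)"
proof -
  let ?x = "fps_const a" and ?y = "fps_const b" and ?z = "fps_const c"
  let ?M = "fps_map \<phi>"
  have M0: "fps_nth (?M u) 0 = fps_nth u 0" for u
    by (simp add: fps_map_def id)
  have P0: "fps_nth (fps_product p u v) 0 = p 0 (fps_nth u 0) (fps_nth v 0)" for p u v
    by (simp add: fps_product_def)
  have "?M (fps_product pf (fps_product pg ?x ?y) ?z) =
      trivial_product f (trivial_product g (?M ?x) (?M ?y)) (?M ?z)
      + trivial_product f (fps_product (defect \<phi> pg g) ?x ?y) (?M ?z)
      + fps_product (defect \<phi> pf f) (fps_product pg ?x ?y) ?z"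
    by (simp only: fps_map_product_defect[OF lin bil(1), where p = pf]
        fps_map_product_defect[OF lin bil(2), where p = pg] trivial_product_add_left[OF bil(1)])
  moreover have "?M (fps_product pf' ?x (fps_product pg' ?y ?z)) =
      trivial_product f' (?M ?x) (trivial_product g' (?M ?y) (?M ?z))
      + trivial_product f' (?M ?x) (fps_product (defect \<phi> pg' g') ?y ?z)
      + fps_product (defect \<phi> pf' f') ?x (fps_product pg' ?y ?z)"
    by (simp only: fps_map_product_defect[OF lin bil(3), where p = pf']
        fps_map_product_defect[OF lin bil(4), where p = pg'] trivial_product_add_right[OF bil(3)])
  ultimately have "trivial_product f (fps_product (defect \<phi> pg g) ?x ?y) (?M ?z)
      + fps_product (defect \<phi> pf f) (fps_product pg ?x ?y) ?z =
      trivial_product f' (?M ?x) (fps_product (defect \<phi> pg' g') ?y ?z)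
      + fps_product (defect \<phi> pf' f') ?x (fps_product pg' ?y ?z)"
    by (simp add: assoc_t trivial_product_assoc[OF bil(1,3) assoc] add.assoc)
  then have "fps_nth (trivial_product f (fps_product (defect \<phi> pg g) ?x ?y) (?M ?z)
      + fps_product (defect \<phi> pf f) (fps_product pg ?x ?y) ?z) N =
      fps_nth (trivial_product f' (?M ?x) (fps_product (defect \<phi> pg' g') ?y ?z)
      + fps_product (defect \<phi> pf' f') ?x (fps_product pg' ?y ?z)) N"
    by (rule arg_cong)
  then show ?thesis
    by (simp add: trivial_product_nth_lowest_left[OF bil(1) fps_product_nth_low[OF low(2)]]
        trivial_product_nth_lowest_right[OF bil(3) fps_product_nth_low[OF low(4)]]
        fps_product_nth_lowest[OF low(1)] fps_product_nth_lowest[OF low(2)]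
        fps_product_nth_lowest[OF low(3)] fps_product_nth_lowest[OF low(4)] M0 P0 init)
qed

lemma defect_update:
  assumes q: "bilinear_map scale q" and id: "\<phi> 0 = id" and init: "p 0 = q" and N: "0 < N"
  shows "defect (\<phi>(N := (\<lambda>a. \<phi> N a + \<psi> a))) p q N a b =
    defect \<phi> p q N a b - (q a (\<psi> b) - \<psi> (q a b) + q (\<psi> a) b)"
proof -
  let ?\<phi> = "\<phi>(N := (\<lambda>a. \<phi> N a + \<psi> a))"
  have "(\<Sum>k\<le>N. ?\<phi> k (p (N - k) a b)) =
      (\<Sum>k\<le>N. \<phi> k (p (N - k) a b) + (if k = N then \<psi> (q a b) else 0))"
    by (rule sum.cong) (auto simp: init)
  moreover have "(\<Sum>k\<le>N. q (?\<phi> k a) (?\<phi> (N - k) b)) =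
      (\<Sum>k\<le>N. q (\<phi> k a) (\<phi> (N - k) b) + (if k = N then q (\<psi> a) b else 0)
        + (if k = 0 then q a (\<psi> b) else 0))"
    using N by (intro sum.cong)
      (auto simp: id bilinear_map_add_left[OF q] bilinear_map_add_right[OF q])
  ultimately show ?thesis
    by (simp add: defect_def sum.distrib)
qed

section \<open>Low-dimensional cochains\<close>

text \<open>The 2-cochain with components \<open>u\<close> at \<open>[1]\<close> and \<open>v\<close> at \<open>[2]\<close>, and value 0 off the domain of
  2-cochains.\<close>

definition two_cochain :: "('a \<Rightarrow> 'a \<Rightarrow> 'a) \<Rightarrow> ('a \<Rightarrow> 'a \<Rightarrow> 'a) \<Rightarrow> nat \<Rightarrow> 'a list \<Rightarrow> 'a::zero" where
  "two_cochain u v r as =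
    (if r \<in> {1..2} \<and> length as = 2 then (if r = 1 then u else v) (as ! 0) (as ! 1) else 0)"

lemma two_cochain_in_cochains:
  assumes "bilinear_map scale u" "bilinear_map scale v"
  shows "two_cochain u v \<in> dend_cochains scale 2"
  using assms unfolding dend_cochains_def bilinear_map_def
  by (auto simp: two_cochain_def less_2_cases_iff)

text \<open>The three hypotheses are the components of \<open>\<delta>(u, v) = 0\<close> at \<open>[1]\<close>, \<open>[2]\<close> and \<open>[3]\<close>.\<close>

lemma two_cochain_in_cocycles:
  assumes "module scale" and u: "bilinear_map scale u" and v: "bilinear_map scale v"
    and prec_prec: "\<And>a b c. prec (u a b) c + u (prec a b) c =
      prec a (u b c + v b c) + u a (prec b c + succ b c)"
    and succ_prec: "\<And>a b c. prec (v a b) c + u (succ a b) c = succ a (u b c) + v a (prec b c)"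
    and succ_succ: "\<And>a b c. succ (u a b + v a b) c + v (prec a b + succ a b) c =
      succ a (v b c) + v a (succ b c)"
  shows "two_cochain u v \<in> dend_cocycles scale prec succ 2"
proof -
  interpret module scale by fact
  have "dend_delta scale prec succ 2 (two_cochain u v) r as = 0" for r as
  proof (cases "r \<in> {1..3} \<and> length as = 3")
    case True
    then obtain a b c where as: "as = [a, b, c]"
      by (auto simp: numeral_3_eq_3 length_Suc_conv)
    have two: "{Suc 0..2} = {Suc 0, 2}" by auto
    from True consider "r = 1" | "r = 2" | "r = 3" by force
    then show ?thesis
    proof cases
      case 1
      then show ?thesis using prec_prec[of a b c]
        by (simp add: as dend_delta_def two R0_def R_def free_ext_def dend_pi_def two_cochain_def
            algebra_simps)
    next
      case 2
      then show ?thesis using succ_prec[of a b c]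
        by (simp add: as dend_delta_def two R0_def R_def free_ext_def dend_pi_def two_cochain_def
            algebra_simps)
    next
      case 3
      then show ?thesis using succ_succ[of a b c]
        by (simp add: as dend_delta_def two R0_def R_def free_ext_def dend_pi_def two_cochain_def
            algebra_simps)
    qed
  qed (auto simp: dend_delta_def)
  then show ?thesis
    using two_cochain_in_cochains[OF u v] by (auto simp: dend_cocycles_def fun_eq_iff)
qed

lemma dend_delta_one:
  assumes "module scale" "r \<in> {1, 2}"
  shows "dend_delta scale prec succ 1 f r [a, b] =
    dend_pi prec succ r a (f 1 [b]) - f 1 [dend_pi prec succ r a b] + dend_pi prec succ r (f 1 [a]) b"
proof -
  interpret module scale by fact
  have two: "{Suc 0..2} = {Suc 0, 2}" by auto
  from assms(2) show ?thesis
    by (auto simp: dend_delta_def two R0_def R_def free_ext_def dend_pi_def)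
qed

lemma cocycle_is_coboundary:
  fixes scale :: "'k::comm_ring_1 \<Rightarrow> 'a::ab_group_add \<Rightarrow> 'a"
  assumes dend: "dendriform_algebra scale prec succ"
    and H2: "dend_cohomology scale prec succ 2 = {dend_coboundaries scale prec succ 2}"
    and z: "z \<in> dend_cocycles scale prec succ 2"
  shows "z \<in> dend_coboundaries scale prec succ 2"
proof -
  interpret dendriform_algebra scale prec succ by fact
  have zero: "(0 :: nat \<Rightarrow> 'a list \<Rightarrow> 'a) \<in> dend_cochains scale 1"
    by (simp add: dend_cochains_def module_hom_iff module_axioms)
  have "dend_delta scale prec succ 1 0 = (0 :: nat \<Rightarrow> 'a list \<Rightarrow> 'a)"
    using bilinear_map_zero_left[OF bilinear_prec] bilinear_map_zero_right[OF bilinear_prec]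
      bilinear_map_zero_left[OF bilinear_succ] bilinear_map_zero_right[OF bilinear_succ]
    by (auto simp: fun_eq_iff dend_delta_def free_ext_def dend_pi_def)
  then have "0 \<in> dend_coboundaries scale prec succ 2"
    unfolding dend_coboundaries_def using zero by (auto simp: image_iff intro!: bexI[of _ 0])
  then have "z + 0 \<in> z +o dend_coboundaries scale prec succ 2"
    by (rule set_plus_intro2)
  also have "z +o dend_coboundaries scale prec succ 2 = dend_coboundaries scale prec succ 2"
    using H2 z unfolding dend_cohomology_def by blast
  finally show ?thesis by simp
qed

text \<open>The form in which the vanishing of \<open>H\<^sup>2\<close> is used: a pair of bilinear maps that satisfies the
  cocycle identities is the coboundary of a linear map.\<close>

lemma trivial_cohomology_two_primitive:
  assumes dend: "dendriform_algebra scale prec succ"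
    and H2: "dend_cohomology scale prec succ 2 = {dend_coboundaries scale prec succ 2}"
    and u: "bilinear_map scale u" and v: "bilinear_map scale v"
    and cocycle: "\<And>a b c. prec (u a b) c + u (prec a b) c =
        prec a (u b c + v b c) + u a (prec b c + succ b c)"
      "\<And>a b c. prec (v a b) c + u (succ a b) c = succ a (u b c) + v a (prec b c)"
      "\<And>a b c. succ (u a b + v a b) c + v (prec a b + succ a b) c =
        succ a (v b c) + v a (succ b c)"
  obtains \<psi> where "module_hom scale scale \<psi>"
    and "\<And>a b. u a b = prec a (\<psi> b) - \<psi> (prec a b) + prec (\<psi> a) b"
    and "\<And>a b. v a b = succ a (\<psi> b) - \<psi> (succ a b) + succ (\<psi> a) b"
proof -
  interpret dendriform_algebra scale prec succ by fact
  have "two_cochain u v \<in> dend_cocycles scale prec succ 2"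
    by (rule two_cochain_in_cocycles[OF module_axioms u v]) (fact cocycle)+
  from cocycle_is_coboundary[OF dend H2 this]
  obtain f where f: "f \<in> dend_cochains scale 1"
    and uv: "two_cochain u v = dend_delta scale prec succ 1 f"
    unfolding dend_coboundaries_def by auto
  show ?thesis
  proof
    have "\<forall>r\<in>{1..1}. \<forall>as. length as = 1 \<longrightarrow> (\<forall>j<1. module_hom scale scale (\<lambda>x. f r (as[j := x])))"
      using f unfolding dend_cochains_def mem_Collect_eq by (rule conjunct1)
    from bspec[OF this, of 1, THEN spec, of "[0]"]
    have "\<forall>j<1. module_hom scale scale (\<lambda>x. f 1 ([0][j := x]))"
      by simp
    then show "module_hom scale scale (\<lambda>x. f 1 [x])" by simp
    fix a b
    have *: "two_cochain u v r [a, b] = dend_pi prec succ r a (f 1 [b])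
        - f 1 [dend_pi prec succ r a b] + dend_pi prec succ r (f 1 [a]) b" if "r \<in> {1, 2}" for r
      unfolding uv by (rule dend_delta_one[OF module_axioms that])
    show "u a b = prec a (f 1 [b]) - f 1 [prec a b] + prec (f 1 [a]) b"
      using *[of 1] by (simp add: two_cochain_def dend_pi_def)
    show "v a b = succ a (f 1 [b]) - f 1 [succ a b] + succ (f 1 [a]) b"
      using *[of 2] by (simp add: two_cochain_def dend_pi_def)
  qed
qed

section \<open>Construction of the equivalence\<close>

text \<open>One step of the construction: the order-\<open>N\<close> defects are a 2-cocycle, hence a coboundary, and a
  primitive \<open>\<psi>\<close> added to \<open>\<phi>\<^sub>N\<close> removes them.\<close>

lemma defect_correction:
  assumes dend: "dendriform_algebra scale prec succ"
    and H2: "dend_cohomology scale prec succ 2 = {dend_coboundaries scale prec succ 2}"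
    and p: "\<And>i. bilinear_map scale (p i)" and s: "\<And>i. bilinear_map scale (s i)"
    and init: "p 0 = prec" "s 0 = succ"
    and dend_t: "dendriform_algebra (fps_scale scale) (fps_product p) (fps_product s)"
    and lin: "\<And>i. module_hom scale scale (\<phi> i)" and id: "\<phi> 0 = id" and N: "0 < N"
    and low: "\<And>m a b. m < N \<Longrightarrow> defect \<phi> p prec m a b = 0"
      "\<And>m a b. m < N \<Longrightarrow> defect \<phi> s succ m a b = 0"
  obtains \<psi> where "module_hom scale scale \<psi>"
    and "\<And>a b. defect (\<phi>(N := (\<lambda>a. \<phi> N a + \<psi> a))) p prec N a b = 0"
    and "\<And>a b. defect (\<phi>(N := (\<lambda>a. \<phi> N a + \<psi> a))) s succ N a b = 0"
proof -
  interpret dendriform_algebra scale prec succ by fact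
  interpret t: dendriform_algebra "fps_scale scale" "fps_product p" "fps_product s" by fact
  let ?u = "defect \<phi> p prec N" and ?v = "defect \<phi> s succ N"
  let ?ps = "\<lambda>i a b. p i a b + s i a b" and ?star = "\<lambda>a b. prec a b + succ a b"
  note bil = bilinear_prec bilinear_succ bilinear_map_plus[OF bilinear_prec bilinear_succ]
  have low_star: "defect \<phi> ?ps ?star m a b = 0" if "m < N" for m a b
    using low that by (simp add: defect_plus[OF lin])
  have star_init: "?ps 0 = ?star" by (simp add: init)
  have u: "bilinear_map scale ?u" and v: "bilinear_map scale ?v"
    by (rule bilinear_map_defect[OF module_axioms lin] p s bil)+
  have prec_star_t: "fps_product p (fps_product p x y) z = fps_product p x (fps_product ?ps y z)" for x y z
    using t.prec_prec by (simp only: fps_product_plus)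
  have star_succ_t: "fps_product s (fps_product ?ps x y) z = fps_product s x (fps_product s y z)" for x y z
    using t.succ_succ by (simp only: fps_product_plus)
  have "prec (?u a b) c + ?u (prec a b) c = prec a (?u b c + ?v b c) + ?u a (?star b c)" for a b c
    using defect_cocycle_identity[where pf = p and pg = p and pf' = p and pg' = ?ps
        and f = prec and g = prec and f' = prec and g' = ?star,
        OF lin id bil(1) bil(1) bil(1) bil(3) init(1) star_init prec_prec prec_star_t
        low(1) low(1) low(1) low_star]
    by (simp only: defect_plus[OF lin])
  moreover have "prec (?v a b) c + ?u (succ a b) c = succ a (?u b c) + ?v a (prec b c)" for a b c
    using defect_cocycle_identity[where pf = p and pg = s and pf' = s and pg' = p
        and f = prec and g = succ and f' = succ and g' = prec,
        OF lin id bil(1) bil(2) bil(2) bil(1) init(2) init(1) succ_prec t.succ_prec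
        low(1) low(2) low(2) low(1)] .
  moreover have "succ (?u a b + ?v a b) c + ?v (?star a b) c = succ a (?v b c) + ?v a (succ b c)"
    for a b c
    using defect_cocycle_identity[where pf = s and pg = ?ps and pf' = s and pg' = s
        and f = succ and g = ?star and f' = succ and g' = succ,
        OF lin id bil(2) bil(3) bil(2) bil(2) star_init init(2) succ_succ star_succ_t
        low(2) low_star low(2) low(2)]
    by (simp only: defect_plus[OF lin])
  ultimately obtain \<psi> where \<psi>: "module_hom scale scale \<psi>"
    "\<And>a b. ?u a b = prec a (\<psi> b) - \<psi> (prec a b) + prec (\<psi> a) b"
    "\<And>a b. ?v a b = succ a (\<psi> b) - \<psi> (succ a b) + succ (\<psi> a) b"
    by (rule trivial_cohomology_two_primitive[OF dend H2 u v]) (rule that)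
  show ?thesis
    by (rule that[of \<psi>])
      (simp_all add: \<psi> defect_update[where \<phi> = \<phi> and p = p, OF bil(1) id init(1) N]
        defect_update[where \<phi> = \<phi> and p = s, OF bil(2) id init(2) N])
qed

lemma defect_free_map_exists:
  assumes dend: "dendriform_algebra scale prec succ"
    and H2: "dend_cohomology scale prec succ 2 = {dend_coboundaries scale prec succ 2}"
    and p: "\<And>i. bilinear_map scale (p i)" and s: "\<And>i. bilinear_map scale (s i)"
    and init: "p 0 = prec" "s 0 = succ"
    and dend_t: "dendriform_algebra (fps_scale scale) (fps_product p) (fps_product s)"
  obtains \<phi> where "\<And>i. module_hom scale scale (\<phi> i)" and "\<phi> 0 = id"
    and "\<And>m a b. defect \<phi> p prec m a b = 0" and "\<And>m a b. defect \<phi> s succ m a b = 0"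
proof -
  interpret dendriform_algebra scale prec succ by fact
  define good where "good n \<phi> \<longleftrightarrow> (\<forall>i. module_hom scale scale (\<phi> i)) \<and> \<phi> 0 = id \<and>
    (\<forall>m\<le>n. \<forall>a b. defect \<phi> p prec m a b = 0 \<and> defect \<phi> s succ m a b = 0)" for n \<phi>
  \<comment> \<open>The \<open>n\<close>-th approximation \<open>\<Phi> n\<close> is never changed again at indices up to \<open>n\<close>, so that the
    diagonal is good at every order.\<close>
  have "\<exists>\<Phi>. \<forall>n. good n (\<Phi> n) \<and> (\<forall>k\<le>n. \<Phi> n k = \<Phi> (Suc n) k)"
  proof (rule dependent_nat_choice)
    show "\<exists>\<phi>. good 0 \<phi>"
      by (rule exI[of _ "\<lambda>i. if i = 0 then id else (\<lambda>_. 0)"])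
        (auto simp: good_def defect_def init module_hom_iff module_axioms)
  next
    fix \<phi> n assume good: "good n \<phi>"
    then have lin: "\<And>i. module_hom scale scale (\<phi> i)" and id: "\<phi> 0 = id"
      and low: "\<And>m a b. m < Suc n \<Longrightarrow> defect \<phi> p prec m a b = 0"
        "\<And>m a b. m < Suc n \<Longrightarrow> defect \<phi> s succ m a b = 0"
      by (auto simp: good_def)
    obtain \<psi> where \<psi>: "module_hom scale scale \<psi>"
      "\<And>a b. defect (\<phi>(Suc n := (\<lambda>a. \<phi> (Suc n) a + \<psi> a))) p prec (Suc n) a b = 0"
      "\<And>a b. defect (\<phi>(Suc n := (\<lambda>a. \<phi> (Suc n) a + \<psi> a))) s succ (Suc n) a b = 0"
      by (rule defect_correction[where \<phi> = \<phi> and N = "Suc n",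
          OF dend H2 p s init dend_t lin id zero_less_Suc low]) (assumption | rule that)+
    let ?\<phi> = "\<phi>(Suc n := (\<lambda>a. \<phi> (Suc n) a + \<psi> a))"
    have lin': "module_hom scale scale (?\<phi> i)" for i
      using lin \<psi>(1) by (auto simp: module_hom_iff algebra_simps)
    have eq: "defect ?\<phi> P Q m = defect \<phi> P Q m" if "m < Suc n" for P Q m
      using that by (intro defect_cong) auto
    have id': "?\<phi> 0 = id"
      using id by simp
    have "defect ?\<phi> p prec m a b = 0 \<and> defect ?\<phi> s succ m a b = 0" if "m \<le> Suc n" for m a b
    proof (cases "m = Suc n")
      case True
      show ?thesis unfolding True using \<psi>(2,3) by blast
    next
      case False
      with that have m: "m < Suc n" by simp
      show ?thesis unfolding eq[OF m] using low[OF m] by blast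
    qed
    then have "good (Suc n) ?\<phi>"
      unfolding good_def using lin' id' by blast
    then show "\<exists>\<phi>'. good (Suc n) \<phi>' \<and> (\<forall>k\<le>n. \<phi> k = \<phi>' k)"
      by (intro exI[of _ ?\<phi>]) auto
  qed
  then obtain \<Phi> where \<Phi>: "\<And>n. good n (\<Phi> n)" and stable: "\<And>n k. k \<le> n \<Longrightarrow> \<Phi> n k = \<Phi> (Suc n) k"
    by blast
  have diag: "\<Phi> k k = \<Phi> n k" if "k \<le> n" for k n
    using that by (induction rule: dec_induct) (simp, metis stable)
  have eq: "defect (\<lambda>k. \<Phi> k k) P Q m = defect (\<Phi> m) P Q m" for P Q m
    by (rule defect_cong) (rule diag)
  show ?thesis
    by (rule that[of "\<lambda>k. \<Phi> k k"]) (use \<Phi> in \<open>auto simp: eq good_def\<close>)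
qed

theorem theorem3p5:
  fixes scale :: "'k::field_char_0 \<Rightarrow> 'a::ab_group_add \<Rightarrow> 'a"
    and prec succ :: "'a \<Rightarrow> 'a \<Rightarrow> 'a"
  assumes "vector_space scale"
    and "dendriform_algebra scale prec succ"
    and "dend_cohomology scale prec succ 2 = {dend_coboundaries scale prec succ 2}"
  shows "dend_rigid scale prec succ"
  unfolding dend_rigid_def
proof (intro allI impI)
  fix prec_t succ_t
  assume "formal_deformation scale prec succ prec_t succ_t"
  then obtain p s where p: "\<And>i. bilinear_map scale (p i)" and s: "\<And>i. bilinear_map scale (s i)"
    and init: "p 0 = prec" "s 0 = succ" and t: "prec_t = fps_product p" "succ_t = fps_product s"
    and dend_t: "dendriform_algebra (fps_scale scale) (fps_product p) (fps_product s)"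
    unfolding formal_deformation_def by blast
  interpret dendriform_algebra scale prec succ by fact
  obtain \<phi> where lin: "\<And>i. module_hom scale scale (\<phi> i)" and id: "\<phi> 0 = id"
    and free: "\<And>m a b. defect \<phi> p prec m a b = 0" "\<And>m a b. defect \<phi> s succ m a b = 0"
    by (rule defect_free_map_exists[OF assms(2,3) p s init dend_t]) (rule that)
  have "fps_product (defect \<phi> p prec) x y = 0" "fps_product (defect \<phi> s succ) x y = 0" for x y
    by (simp_all add: fps_product_def fps_eq_iff free)
  then have "fps_map \<phi> (fps_product p x y) = trivial_product prec (fps_map \<phi> x) (fps_map \<phi> y)"
    "fps_map \<phi> (fps_product s x y) = trivial_product succ (fps_map \<phi> x) (fps_map \<phi> y)" for x y
    by (simp_all add: fps_map_product_defect[OF lin bilinear_prec, where p = p]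
        fps_map_product_defect[OF lin bilinear_succ, where p = s])
  then show "equivalent_deformations scale prec_t succ_t (trivial_product prec) (trivial_product succ)"
    unfolding equivalent_deformations_def t using lin id by blast
qed

end
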